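(* Let $\lambda\in(-\infty,0]$, $\kappa\in(0,\infty]$, $\epsilon>0$, $d\in\mathbb{N}$, $M\in\mathcal{H}$, and let $G$ be a linear, bounded and causal operator on $\ell^2$. Then $$\left\langle \begin{pmatrix} Gw\\ w\end{pmatrix},\ \Pi_M(\lambda,\kappa)\begin{pmatrix} Gw\\ w\end{pmatrix}\right\rangle\le -\epsilon\|w\|^2\quad\text{for all } w\in \ell^2$$ holds if and only if $$\left\langle \begin{pmatrix} (G\otimes I_d)w\\ w\end{pmatrix},\ \Pi_{M\otimes I_d}(\lambda,\kappa)\begin{pmatrix} (G\otimes I_d)w\\ w\end{pmatrix}\right\rangle\le -\epsilon\|w\|^2\quad\text{for all } w\in \ell^2_d .$$
   Context: $\ell^2_d$ is the Hilbert space of square summable sequences $x:\mathbb{N}_0\to\mathbb{R}^d$ with $\langle x,y\rangle=\sum_{k\ge 0}x_k^\top y_k$; $\ell^2=\ell^2_1$. $\otimes$ is the Kronecker product; for an operator $T$ on $\ell^2$, $T\otimes I_d$ is the operator on $\ell^2_d$ acting as $T$ on each of the $d$ scalar components of a signal. $\mathcal{H}$ is the set of infinite real Toeplitz matrices $M=(m_{i-j})_{i,j=0}^\infty$ that are doubly hyperdominant: $m_j\le 0$ for $j\neq 0$, the series $\sum_{j=-\infty}^\infty m_j$ converges, and $\sum_{j=-\infty}^\infty m_j\ge 0$; such $M$ acts as a bounded operator on $\ell^2$. For a bounded operator $M$ with adjoint $M^*$, and with the convention $1/\infty=0$, $$\Pi_M(\lambda,\kappa)=\begin{pmatrix}-\lambda(M+M^*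 ) & M^*+\frac{\lambda}{\kappa}M\\ M+\frac{\lambda}{\kappa}M^* & -\frac1\kappa(M+M^* )\end{pmatrix}.$$ *)

theory Defs
  imports "HOL-Analysis.Analysis"
begin

section \<open>The space of square summable sequences\<close>

typedef (overloaded) 'a l2 =
    "{x :: nat \<Rightarrow> 'a::real_inner. summable (\<lambda>k. (norm (x k))\<^sup>2)}"
  morphisms nth_l2 Abs_l2
  by (rule exI[of _ "\<lambda>_. 0"]) simp

setup_lifting type_definition_l2

lemma summable_nth_l2: "summable (\<lambda>k. (norm (nth_l2 x k))\<^sup>2)"
  using nth_l2[of x] by simp

lemma l2_eqI: "(\<And>k. nth_l2 x k = nth_l2 y k) \<Longrightarrow> x = y"
  by (simp add: nth_l2_inject[symmetric] ext)

lemma sq_norm_add_le: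
  fixes a b :: "'a::real_inner"
  shows "(norm (a + b))\<^sup>2 \<le> 2 * (norm a)\<^sup>2 + 2 * (norm b)\<^sup>2"
proof -
  have "(norm (a + b))\<^sup>2 \<le> (norm a + norm b)\<^sup>2"
    by (intro power_mono norm_triangle_ineq norm_ge_zero)
  also have "\<dots> \<le> 2 * (norm a)\<^sup>2 + 2 * (norm b)\<^sup>2"
    using zero_le_power2[of "norm a - norm b"] by (simp add: power2_sum power2_diff)
  finally show ?thesis .
qed

lemma summable_l2_add:
  fixes x y :: "nat \<Rightarrow> 'a::real_inner"
  assumes "summable (\<lambda>k. (norm (x k))\<^sup>2)" "summable (\<lambda>k. (norm (y k))\<^sup>2)"
  shows "summable (\<lambda>k. (norm (x k + y k))\<^sup>2)"
proof (rule summable_comparison_test')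
  show "summable (\<lambda>k. 2 * (norm (x k))\<^sup>2 + 2 * (norm (y k))\<^sup>2)"
    by (intro summable_add summable_mult assms)
  show "norm ((norm (x k + y k))\<^sup>2) \<le> 2 * (norm (x k))\<^sup>2 + 2 * (norm (y k))\<^sup>2" if "k \<ge> 0" for k
    using sq_norm_add_le[of "x k" "y k"] by simp
qed

lemma summable_l2_scaleR:
  fixes x :: "nat \<Rightarrow> 'a::real_inner"
  assumes "summable (\<lambda>k. (norm (x k))\<^sup>2)"
  shows "summable (\<lambda>k. (norm (c *\<^sub>R x k))\<^sup>2)"
  by (simp add: power_mult_distrib summable_mult assms)

lemma summable_l2_inner:
  fixes x y :: "nat \<Rightarrow> 'a::real_inner"
  assumes "summable (\<lambda>k. (norm (x k))\<^sup>2)" "summable (\<lambda>k. (norm (y k))\<^sup>2)"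
  shows "summable (\<lambda>k. x k \<bullet> y k)"
proof (rule summable_comparison_test')
  show "summable (\<lambda>k. (norm (x k))\<^sup>2 + (norm (y k))\<^sup>2)"
    by (intro summable_add assms)
  show "norm (x k \<bullet> y k) \<le> (norm (x k))\<^sup>2 + (norm (y k))\<^sup>2" if "k \<ge> 0" for k
  proof -
    have "norm (x k \<bullet> y k) \<le> norm (x k) * norm (y k)"
      using Cauchy_Schwarz_ineq2 by simp
    moreover have "2 * (norm (x k) * norm (y k)) \<le> (norm (x k))\<^sup>2 + (norm (y k))\<^sup>2"
      using zero_le_power2[of "norm (x k) - norm (y k)"] by (simp add: power2_diff)
    moreover have "0 \<le> norm (x k) * norm (y k)" by simp
    ultimately show ?thesis by linarith
  qed
qed

instantiation l2 :: (real_inner) real_inner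
begin

lift_definition zero_l2 :: "'a l2" is "\<lambda>_. 0" by simp

lift_definition plus_l2 :: "'a l2 \<Rightarrow> 'a l2 \<Rightarrow> 'a l2" is "\<lambda>x y k. x k + y k"
  by (rule summable_l2_add)

lift_definition uminus_l2 :: "'a l2 \<Rightarrow> 'a l2" is "\<lambda>x k. - x k" by simp

lift_definition minus_l2 :: "'a l2 \<Rightarrow> 'a l2 \<Rightarrow> 'a l2" is "\<lambda>x y k. x k - y k"
  subgoal for x y using summable_l2_add[of x "\<lambda>k. - y k"] by simp
  done

lift_definition scaleR_l2 :: "real \<Rightarrow> 'a l2 \<Rightarrow> 'a l2" is "\<lambda>c x k. c *\<^sub>R x k"
  by (rule summable_l2_scaleR)

lift_definition inner_l2 :: "'a l2 \<Rightarrow> 'a l2 \<Rightarrow> real" is "\<lambda>x y. \<Sum>k. x k \<bullet> y k" .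

definition norm_l2 :: "'a l2 \<Rightarrow> real" where "norm_l2 x = sqrt (x \<bullet> x)"

definition dist_l2 :: "'a l2 \<Rightarrow> 'a l2 \<Rightarrow> real" where "dist_l2 x y = norm (x - y)"

definition sgn_l2 :: "'a l2 \<Rightarrow> 'a l2" where "sgn_l2 x = inverse (norm x) *\<^sub>R x"

definition uniformity_l2 :: "('a l2 \<times> 'a l2) filter" where
  "uniformity_l2 = (INF e\<in>{0<..}. principal {(x, y). dist x y < e})"

definition open_l2 :: "'a l2 set \<Rightarrow> bool" where
  "open_l2 U = (\<forall>x\<in>U. \<forall>\<^sub>F (x', y) in uniformity. x' = x \<longrightarrow> y \<in> U)"

instance
proof
  fix x y z :: "'a l2" and a b :: real
  show "x + y + z = x + (y + z)" by transfer (simp add: add.assoc)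
  show "x + y = y + x" by transfer (simp add: add.commute)
  show "0 + x = x" by transfer simp
  show "- x + x = 0" by transfer simp
  show "x - y = x + - y" by transfer simp
  show "a *\<^sub>R (x + y) = a *\<^sub>R x + a *\<^sub>R y" by transfer (simp add: scaleR_add_right)
  show "(a + b) *\<^sub>R x = a *\<^sub>R x + b *\<^sub>R x" by transfer (simp add: scaleR_add_left)
  show "a *\<^sub>R b *\<^sub>R x = (a * b) *\<^sub>R x" by transfer simp
  show "1 *\<^sub>R x = x" by transfer simp
  show "dist x y = norm (x - y)" by (rule dist_l2_def)
  show "sgn x = inverse (norm x) *\<^sub>R x" by (rule sgn_l2_def)
  show "uniformity = (INF e\<in>{0<..}. principal {(x, y :: 'a l2). dist x y < e})"
    by (rule uniformity_l2_def)
  show "open U = (\<forall>x\<in>U. \<forall>\<^sub>F (x', y) in uniformity. x' = x \<longrightarrow> y \<in> U)" for U :: "'a l2 set"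
    by (rule open_l2_def)
  show "x \<bullet> y = y \<bullet> x" by transfer (simp add: inner_commute)
  show "(x + y) \<bullet> z = x \<bullet> z + y \<bullet> z"
    by transfer (simp add: inner_add_left suminf_add summable_l2_inner)
  show "(a *\<^sub>R x) \<bullet> y = a * (x \<bullet> y)"
    by transfer (simp add: suminf_mult summable_l2_inner)
  show "0 \<le> x \<bullet> x" by transfer (simp add: suminf_nonneg summable_l2_inner)
  show "x \<bullet> x = 0 \<longleftrightarrow> x = 0"
    by transfer (auto simp: suminf_eq_zero_iff summable_l2_inner fun_eq_iff)
  show "norm x = sqrt (x \<bullet> x)" by (rule norm_l2_def)
qed

end

section \<open>Operators\<close>

definition causal :: "('a::real_inner l2 \<Rightarrow> 'b::real_inner l2) \<Rightarrow> bool" where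
  "causal G \<longleftrightarrow> (\<forall>n x y. (\<forall>k\<le>n. nth_l2 x k = nth_l2 y k) \<longrightarrow>
                         (\<forall>k\<le>n. nth_l2 (G x) k = nth_l2 (G y) k))"

lift_definition component_l2 :: "'d::finite \<Rightarrow> (real ^ 'd) l2 \<Rightarrow> real l2"
  is "\<lambda>i x k. x k $ i"
proof -
  fix i :: 'd and x :: "nat \<Rightarrow> real ^ 'd"
  assume x: "summable (\<lambda>k. (norm (x k))\<^sup>2)"
  show "summable (\<lambda>k. (norm (x k $ i))\<^sup>2)"
  proof (rule summable_comparison_test'[OF x])
    show "norm ((norm (x k $ i))\<^sup>2) \<le> (norm (x k))\<^sup>2" if "k \<ge> 0" for k
      using power_mono[OF component_le_norm_cart[of "x k" i] abs_ge_zero, of 2] by simp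
  qed
qed

lift_definition vector_l2 :: "('d::finite \<Rightarrow> real l2) \<Rightarrow> (real ^ 'd) l2"
  is "\<lambda>f k. \<chi> i. f i k"
proof -
  fix f :: "'d \<Rightarrow> nat \<Rightarrow> real"
  assume f: "\<And>i. summable (\<lambda>k. (norm (f i k))\<^sup>2)"
  have "(norm (\<chi> i. f i k))\<^sup>2 = (\<Sum>i\<in>UNIV. (norm (f i k))\<^sup>2)" for k
    by (simp add: norm_vec_def L2_set_def sum_nonneg)
  then show "summable (\<lambda>k. (norm (\<chi> i. f i k))\<^sup>2)"
    using f by (simp add: summable_sum)
qed

text \<open>\<open>T \<otimes> I\<^sub>d\<close> with \<open>d = CARD('d)\<close>.\<close>

definition kron_id :: "(real l2 \<Rightarrow> real l2) \<Rightarrow> (real ^ 'd::finite) l2 \<Rightarrow> (real ^ 'd) l2" where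
  "kron_id T w = vector_l2 (\<lambda>i. T (component_l2 i w))"

text \<open>
  The operator of an infinite matrix. It is meaningful only if the matrix maps
  square summable sequences to square summable sequences; the lemmas
  \<open>nth_matrix_op\<close> and \<open>bounded_linear_matrix_op\<close> below establish this for doubly
  hyperdominant matrices.
\<close>

definition matrix_op :: "(nat \<Rightarrow> nat \<Rightarrow> real) \<Rightarrow> real l2 \<Rightarrow> real l2" where
  "matrix_op M x = Abs_l2 (\<lambda>i. \<Sum>j. M i j * nth_l2 x j)"

text \<open>
  The entries \<open>m j\<close> with \<open>j \<noteq> 0\<close> all have the same sign, so every notion of convergence
  of the two-sided series agrees with unconditional summability over \<open>UNIV :: int set\<close>.
\<close>

definition doubly_hyperdominant_toeplitz :: "(nat \<Rightarrow> nat \<Rightarrow> real) set" where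
  "doubly_hyperdominant_toeplitz =
     {M. \<exists>m :: int \<Rightarrow> real. (\<forall>i j. M i j = m (int i - int j)) \<and>
           (\<forall>j. j \<noteq> 0 \<longrightarrow> m j \<le> 0) \<and> m summable_on UNIV \<and> 0 \<le> infsum m UNIV}"

lemma schur_finite:
  fixes m :: "int \<Rightarrow> real" and x :: "nat \<Rightarrow> real"
  assumes m: "m summable_on UNIV"
  defines "S \<equiv> infsum (\<lambda>k. \<bar>m k\<bar>) UNIV"
  shows "(\<Sum>i<N. (\<Sum>j<K. m (int i - int j) * x j)\<^sup>2) \<le> S\<^sup>2 * (\<Sum>j<K. (x j)\<^sup>2)"
proof -
  have abs: "(\<lambda>k. \<bar>m k\<bar>) summable_on UNIV"
    using m summable_on_iff_abs_summable_on_real[of m UNIV] by (simp only: real_norm_def)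
  have S0: "0 \<le> S" unfolding S_def by (rule infsum_nonneg) simp
  have le_S: "(\<Sum>j\<in>A. \<bar>m (f j)\<bar>) \<le> S" if "finite A" "inj_on f A" for A :: "nat set" and f
  proof -
    have "(\<Sum>j\<in>A. \<bar>m (f j)\<bar>) = (\<Sum>k\<in>f ` A. \<bar>m k\<bar>)"
      using that by (simp add: sum.reindex)
    also have "\<dots> \<le> S"
      unfolding S_def by (rule finite_sum_le_infsum[OF abs]) (simp_all add: that(1))
    finally show ?thesis .
  qed
  have row: "(\<Sum>j<K. m (int i - int j) * x j)\<^sup>2
               \<le> S * (\<Sum>j<K. \<bar>m (int i - int j)\<bar> * (x j)\<^sup>2)" for i
  proof -
    let ?u = "\<lambda>j. \<bar>m (int i - int j)\<bar>"
    have "\<bar>\<Sum>j<K. m (int i - int j) * x j\<bar> \<le> (\<Sum>j<K. sqrt (?u j) * (sqrt (?u j) * \<bar>x j\<bar>))"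
      by (rule order_trans[OF sum_abs]) (simp add: abs_mult mult.assoc[symmetric])
    then have "\<bar>\<Sum>j<K. m (int i - int j) * x j\<bar>\<^sup>2
                 \<le> (\<Sum>j<K. sqrt (?u j) * (sqrt (?u j) * \<bar>x j\<bar>))\<^sup>2"
      by (rule power_mono) simp
    also have "\<dots> \<le> (\<Sum>j<K. (sqrt (?u j))\<^sup>2) * (\<Sum>j<K. (sqrt (?u j) * \<bar>x j\<bar>)\<^sup>2)"
      by (rule Cauchy_Schwarz_ineq_sum)
    also have "\<dots> = (\<Sum>j<K. ?u j) * (\<Sum>j<K. ?u j * (x j)\<^sup>2)"
      by (simp add: power_mult_distrib)
    also have "\<dots> \<le> S * (\<Sum>j<K. ?u j * (x j)\<^sup>2)"
      by (rule mult_right_mono[OF le_S]) (auto simp: inj_on_def intro!: sum_nonneg)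
    finally show ?thesis by simp
  qed
  have "(\<Sum>i<N. (\<Sum>j<K. m (int i - int j) * x j)\<^sup>2)
          \<le> (\<Sum>i<N. S * (\<Sum>j<K. \<bar>m (int i - int j)\<bar> * (x j)\<^sup>2))"
    by (rule sum_mono) (rule row)
  also have "\<dots> = S * (\<Sum>j<K. (\<Sum>i<N. \<bar>m (int i - int j)\<bar>) * (x j)\<^sup>2)"
    by (subst sum_distrib_left[symmetric], subst sum.swap) (simp add: sum_distrib_right)
  also have "\<dots> \<le> S * (\<Sum>j<K. S * (x j)\<^sup>2)"
    by (intro mult_left_mono sum_mono mult_right_mono le_S S0) (auto simp: inj_on_def)
  also have "\<dots> = S\<^sup>2 * (\<Sum>j<K. (x j)\<^sup>2)"
    by (simp add: sum_distrib_left power2_eq_square mult.assoc)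
  finally show ?thesis .
qed

lemma summable_toeplitz_row:
  fixes m :: "int \<Rightarrow> real" and x :: "real l2"
  assumes m: "m summable_on UNIV"
  shows "summable (\<lambda>j. m (int i - int j) * nth_l2 x j)"
proof -
  define S where "S = infsum (\<lambda>k. \<bar>m k\<bar>) UNIV"
  have abs: "(\<lambda>k. \<bar>m k\<bar>) summable_on UNIV"
    using m summable_on_iff_abs_summable_on_real[of m UNIV] by (simp only: real_norm_def)
  have S0: "0 \<le> S" unfolding S_def by (rule infsum_nonneg) simp
  have one: "\<bar>m k\<bar> \<le> S" for k
    unfolding S_def using finite_sum_le_infsum[OF abs, of "{k}"] by simp
  have part: "(\<Sum>j<K. \<bar>m (int i - int j)\<bar>) \<le> S" for K
  proof -
    have inj: "inj_on (\<lambda>j. int i - int j) {..<K}" by (auto simp: inj_on_def)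
    have "(\<Sum>j<K. \<bar>m (int i - int j)\<bar>) = (\<Sum>k\<in>(\<lambda>j. int i - int j) ` {..<K}. \<bar>m k\<bar>)"
      by (simp add: sum.reindex[OF inj])
    also have "\<dots> \<le> S"
      unfolding S_def by (rule finite_sum_le_infsum[OF abs]) simp_all
    finally show ?thesis .
  qed
  have sm: "summable (\<lambda>j. \<bar>m (int i - int j)\<bar>)"
    by (rule summableI_nonneg_bounded[of _ S]) (auto intro: part)
  have sx: "summable (\<lambda>j. (nth_l2 x j)\<^sup>2)"
    using summable_nth_l2[of x] by simp
  show ?thesis
  proof (rule summable_comparison_test')
    show "summable (\<lambda>j. \<bar>m (int i - int j)\<bar> + S * (nth_l2 x j)\<^sup>2)"
      by (intro summable_add summable_mult sm sx)
    fix j :: nat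
    let ?a = "\<bar>m (int i - int j)\<bar>" and ?b = "\<bar>nth_l2 x j\<bar>"
    have "?b \<le> 1 + (nth_l2 x j)\<^sup>2"
      using zero_le_power2[of "?b - 1"] by (simp add: power2_diff)
    then have "?a * ?b \<le> ?a * (1 + (nth_l2 x j)\<^sup>2)" by (rule mult_left_mono) simp
    also have "\<dots> \<le> ?a + S * (nth_l2 x j)\<^sup>2"
      using mult_right_mono[OF one, of "(nth_l2 x j)\<^sup>2" "int i - int j"]
      by (simp add: distrib_left)
    finally show "norm (m (int i - int j) * nth_l2 x j) \<le> ?a + S * (nth_l2 x j)\<^sup>2"
      by (simp add: abs_mult)
  qed
qed

lemma norm_l2_sq: "(norm x)\<^sup>2 = (\<Sum>k. (norm (nth_l2 x k))\<^sup>2)" for x :: "'a::real_inner l2"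
proof -
  have "(norm x)\<^sup>2 = x \<bullet> x" by (simp add: power2_norm_eq_inner)
  also have "\<dots> = (\<Sum>k. (norm (nth_l2 x k))\<^sup>2)"
    by (simp add: inner_l2.rep_eq power2_norm_eq_inner)
  finally show ?thesis .
qed

lemma schur_partial:
  fixes m :: "int \<Rightarrow> real" and x :: "real l2"
  assumes m: "m summable_on UNIV"
  shows "(\<Sum>i<N. (\<Sum>j. m (int i - int j) * nth_l2 x j)\<^sup>2)
           \<le> (infsum (\<lambda>k. \<bar>m k\<bar>) UNIV)\<^sup>2 * (norm x)\<^sup>2"
proof -
  let ?S = "infsum (\<lambda>k. \<bar>m k\<bar>) UNIV"
  have lim: "(\<lambda>K. \<Sum>i<N. (\<Sum>j<K. m (int i - int j) * nth_l2 x j)\<^sup>2)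
          \<longlonglongrightarrow> (\<Sum>i<N. (\<Sum>j. m (int i - int j) * nth_l2 x j)\<^sup>2)"
    by (intro tendsto_sum tendsto_power summable_LIMSEQ summable_toeplitz_row m)
  have bound: "(\<Sum>i<N. (\<Sum>j<K. m (int i - int j) * nth_l2 x j)\<^sup>2) \<le> ?S\<^sup>2 * (norm x)\<^sup>2" for K
  proof -
    have "(\<Sum>j<K. (nth_l2 x j)\<^sup>2) \<le> (norm x)\<^sup>2"
      unfolding norm_l2_sq
      using sum_le_suminf[OF summable_nth_l2[of x], of "{..<K}"] by simp
    then show ?thesis
      by (intro order_trans[OF schur_finite[OF m]] mult_left_mono) auto
  qed
  show ?thesis
    by (rule LIMSEQ_le_const2[OF lim]) (use bound in blast)
qed

lemma summable_matrix_op: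
  assumes "M \<in> doubly_hyperdominant_toeplitz"
  shows "summable (\<lambda>j. M i j * nth_l2 x j)"
  using assms summable_toeplitz_row by (auto simp: doubly_hyperdominant_toeplitz_def)

lemma nth_matrix_op:
  assumes "M \<in> doubly_hyperdominant_toeplitz"
  shows "nth_l2 (matrix_op M x) i = (\<Sum>j. M i j * nth_l2 x j)"
proof -
  obtain m where M: "\<And>i j. M i j = m (int i - int j)" and m: "m summable_on UNIV"
    using assms by (auto simp: doubly_hyperdominant_toeplitz_def)
  have "summable (\<lambda>i. (norm (\<Sum>j. M i j * nth_l2 x j))\<^sup>2)"
    by (rule summableI_nonneg_bounded) (use schur_partial[OF m] in \<open>auto simp: M\<close>)
  then show ?thesis
    unfolding matrix_op_def by (subst Abs_l2_inverse) auto
qed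

lemma bounded_linear_matrix_op:
  assumes "M \<in> doubly_hyperdominant_toeplitz"
  shows "bounded_linear (matrix_op M)"
proof -
  obtain m where M: "\<And>i j. M i j = m (int i - int j)" and m: "m summable_on UNIV"
    using assms by (auto simp: doubly_hyperdominant_toeplitz_def)
  let ?S = "infsum (\<lambda>k. \<bar>m k\<bar>) UNIV"
  have S0: "0 \<le> ?S" by (rule infsum_nonneg) simp
  note sums = summable_matrix_op[OF assms]
  show ?thesis
  proof (rule bounded_linear_intro[where K = ?S])
    fix x y :: "real l2" and r :: real
    show "matrix_op M (x + y) = matrix_op M x + matrix_op M y"
      by (rule l2_eqI)
         (simp add: nth_matrix_op[OF assms] plus_l2.rep_eq distrib_left suminf_add sums)
    have "(\<Sum>j. r * (M i j * nth_l2 x j)) = r * (\<Sum>j. M i j * nth_l2 x j)" for i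
      by (rule suminf_mult[OF sums])
    then show "matrix_op M (r *\<^sub>R x) = r *\<^sub>R matrix_op M x"
      by (intro l2_eqI)
         (simp add: nth_matrix_op[OF assms] scaleR_l2.rep_eq mult.left_commute)
    have "(norm (matrix_op M x))\<^sup>2 \<le> ?S\<^sup>2 * (norm x)\<^sup>2"
      unfolding norm_l2_sq[of "matrix_op M x"]
      by (rule suminf_le_const[OF summable_nth_l2])
         (use schur_partial[OF m] in \<open>simp add: nth_matrix_op[OF assms] M\<close>)
    then have "(norm (matrix_op M x))\<^sup>2 \<le> (norm x * ?S)\<^sup>2"
      by (simp add: power_mult_distrib mult.commute)
    then show "norm (matrix_op M x) \<le> norm x * ?S"
      by (rule power2_le_imp_le) (simp add: S0)
  qed
qed

text \<open>
  The block operator \<open>\<Pi>\<^sub>M(\<lambda>, \<kappa>)\<close>, with \<open>M\<^sup>*\<close> the library \<^const>\<open>adjoint\<close>. The parameter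
  \<open>k\<close> is extended real to admit \<open>\<kappa> = \<infinity>\<close>; in \<^typ>\<open>ereal\<close> one has \<open>1 / \<infinity> = 0\<close>.
\<close>

definition multiplier_op ::
    "('a::real_inner \<Rightarrow> 'a) \<Rightarrow> real \<Rightarrow> ereal \<Rightarrow> 'a \<times> 'a \<Rightarrow> 'a \<times> 'a" where
  "multiplier_op M l k =
     (\<lambda>(y, w). let r = real_of_ereal (1 / k); M' = adjoint M in
        (- (l *\<^sub>R (M y + M' y)) + (M' w + (l * r) *\<^sub>R M w),
         (M y + (l * r) *\<^sub>R M' y) - r *\<^sub>R (M w + M' w)))"

end

theory Submission
  imports Defs
begin

text \<open>
  Every operator involved acts componentwise, and \<open>\<ell>\<^sup>2\<^sub>d\<close> is the orthogonal sum of
  \<open>d\<close> copies of \<open>\<ell>\<^sup>2\<close>, so the quadratic form on \<open>\<ell>\<^sup>2\<^sub>d\<close> is the sum of the scalar forms of the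
  components; conversely the scalar form is recovered from signals with a single nonzero
  component. As \<^const>\<open>adjoint\<close> is a choice that means something only where an adjoint exists,
  the adjoint of \<open>M\<close> has to be exhibited: it is the operator of the transposed matrix.
\<close>

text \<open>Transposition reflects the symbol \<open>m\<close> to \<open>m (- j)\<close>, which
  fixes \<open>0\<close> and only reindexes the two-sided sum. Hence the series and boundedness
  facts for \<open>M\<close> are also available for its transpose.\<close>

lemma doubly_hyperdominant_toeplitz_transpose:
  assumes "M \<in> doubly_hyperdominant_toeplitz"
  shows "(\<lambda>i j. M j i) \<in> doubly_hyperdominant_toeplitz"
proof -
  obtain m where m: "\<And>i j. M i j = m (int i - int j)" "\<And>j. j \<noteq> 0 \<Longrightarrow> m j \<le> 0"
      "m summable_on UNIV" "0 \<le> infsum m UNIV"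
    using assms by (auto simp: doubly_hyperdominant_toeplitz_def)
  have bij: "bij_betw uminus (UNIV :: int set) UNIV"
    by (rule bij_uminus)
  have "(\<lambda>j. m (- j)) summable_on UNIV" "infsum (\<lambda>j. m (- j)) UNIV = infsum m UNIV"
    using summable_on_reindex_bij_betw[OF bij, of m] infsum_reindex_bij_betw[OF bij, of m] m(3)
    by auto
  with m show ?thesis
    unfolding doubly_hyperdominant_toeplitz_def
    by (intro CollectI exI[of _ "\<lambda>j. m (- j)"]) auto
qed

text \<open>Cutting signals off makes one of the two sums in
  \<open>matrix_op M x \<bullet> y\<close> finite; the general case follows by continuity.\<close>

lift_definition truncate_l2 :: "nat \<Rightarrow> 'a::real_inner l2 \<Rightarrow> 'a l2"
  is "\<lambda>n x k. if k < n then x k else 0"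
  by (rule summable_finite[of "{..<n}" for n]) auto

text \<open>The squared error is the tail of the convergent series for the squared norm of
  \<open>x\<close>.\<close>

lemma truncate_l2_tendsto: "(\<lambda>n. truncate_l2 n x) \<longlonglongrightarrow> x"
proof -
  let ?f = "\<lambda>k. (norm (nth_l2 x k))\<^sup>2"
  have "(norm (truncate_l2 n x - x))\<^sup>2 = (\<Sum>k. ?f k) - (\<Sum>k<n. ?f k)" for n
  proof -
    have "(norm (truncate_l2 n x - x))\<^sup>2 = (\<Sum>k. ?f k - (if k \<in> {..<n} then ?f k else 0))"
      unfolding norm_l2_sq
      by (intro suminf_cong) (simp add: minus_l2.rep_eq truncate_l2.rep_eq)
    also have "\<dots> = (\<Sum>k. ?f k) - (\<Sum>k. if k \<in> {..<n} then ?f k else 0)"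
      by (intro suminf_diff[symmetric] summable_nth_l2 summable_If_finite_set) simp
    also have "(\<Sum>k. if k \<in> {..<n} then ?f k else 0) = (\<Sum>k<n. ?f k)"
      by (subst suminf_finite[of "{..<n}"]) auto
    finally show ?thesis .
  qed
  moreover have "(\<lambda>n. (\<Sum>k. ?f k) - (\<Sum>k<n. ?f k)) \<longlonglongrightarrow> (\<Sum>k. ?f k) - (\<Sum>k. ?f k)"
    by (intro tendsto_diff tendsto_const summable_LIMSEQ summable_nth_l2)
  ultimately have "(\<lambda>n. (norm (truncate_l2 n x - x))\<^sup>2) \<longlonglongrightarrow> 0"
    by simp
  then have "(\<lambda>n. sqrt ((norm (truncate_l2 n x - x))\<^sup>2)) \<longlonglongrightarrow> sqrt 0"
    by (rule tendsto_real_sqrt)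
  then show ?thesis
    by (simp add: LIM_zero_iff tendsto_norm_zero_iff)
qed

lemma inner_matrix_op_truncate_l2:
  assumes "M \<in> doubly_hyperdominant_toeplitz"
  shows "matrix_op M (truncate_l2 n x) \<bullet> y
           = (\<Sum>j<n. nth_l2 x j * nth_l2 (matrix_op (\<lambda>i j. M j i) y) j)"
proof -
  note tr = doubly_hyperdominant_toeplitz_transpose[OF assms]
  \<comment> \<open>A column of \<open>M\<close> is a row of its transpose.\<close>
  have sy: "summable (\<lambda>i. M i j * nth_l2 y i)" for j
    using summable_matrix_op[OF tr] .
  have "nth_l2 (matrix_op M (truncate_l2 n x)) i = (\<Sum>j<n. M i j * nth_l2 x j)" for i
    unfolding nth_matrix_op[OF assms]
    by (subst suminf_finite[of "{..<n}"]) (auto simp: truncate_l2.rep_eq)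
  \<comment> \<open>With \<open>j\<close> ranging over a finite set, the two sums may be exchanged
    using convergence along each column alone.\<close>
  then have "matrix_op M (truncate_l2 n x) \<bullet> y
      = (\<Sum>i. \<Sum>j<n. nth_l2 x j * (M i j * nth_l2 y i))"
    by (simp add: inner_l2.rep_eq sum_distrib_left mult_ac)
  also have "\<dots> = (\<Sum>j<n. \<Sum>i. nth_l2 x j * (M i j * nth_l2 y i))"
    by (intro suminf_sum summable_mult sy)
  also have "\<dots> = (\<Sum>j<n. nth_l2 x j * (\<Sum>i. M i j * nth_l2 y i))"
    by (intro sum.cong refl suminf_mult sy)
  finally show ?thesis
    by (simp add: nth_matrix_op[OF tr])
qed

lemma inner_matrix_op_transpose:
  assumes "M \<in> doubly_hyperdominant_toeplitz"
  shows "matrix_op M x \<bullet> y = x \<bullet> matrix_op (\<lambda>i j. M j i) y"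
proof (rule LIMSEQ_unique)
  \<comment> \<open>The same sequence is given two limits: this one by continuity of
    \<open>matrix_op M\<close>, the other because its terms are the partial sums of
    \<open>x \<bullet> ?z\<close>.\<close>
  show "(\<lambda>n. matrix_op M (truncate_l2 n x) \<bullet> y) \<longlonglongrightarrow> matrix_op M x \<bullet> y"
    by (intro tendsto_inner tendsto_const truncate_l2_tendsto
        bounded_linear.tendsto[OF bounded_linear_matrix_op[OF assms]])
  let ?z = "matrix_op (\<lambda>i j. M j i) y"
  have "summable (\<lambda>j. nth_l2 x j * nth_l2 ?z j)"
    using summable_l2_inner[OF summable_nth_l2 summable_nth_l2, of x ?z] by simp
  from summable_LIMSEQ[OF this]
  show "(\<lambda>n. matrix_op M (truncate_l2 n x) \<bullet> y) \<longlonglongrightarrow> x \<bullet> ?z"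
    unfolding inner_matrix_op_truncate_l2[OF assms] by (simp add: inner_l2.rep_eq)
qed

lemma component_kron_id [simp]: "component_l2 i (kron_id T w) = T (component_l2 i w)"
  unfolding kron_id_def
  by (rule l2_eqI) (simp add: component_l2.rep_eq vector_l2.rep_eq)

lemma component_vector_l2 [simp]: "component_l2 i (vector_l2 f) = f i"
  by (rule l2_eqI) (simp add: component_l2.rep_eq vector_l2.rep_eq)

lemma inner_component_l2:
  fixes x y :: "(real ^ 'd::finite) l2"
  shows "x \<bullet> y = (\<Sum>i\<in>UNIV. component_l2 i x \<bullet> component_l2 i y)"
proof -
  have "summable (\<lambda>k. nth_l2 x k $ i * nth_l2 y k $ i)" for i
    using summable_l2_inner[OF summable_nth_l2 summable_nth_l2,
        of "component_l2 i x" "component_l2 i y"]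
    by (simp add: component_l2.rep_eq)
  then show ?thesis
    by (simp add: inner_l2.rep_eq component_l2.rep_eq inner_vec_def suminf_sum)
qed

lemma norm_component_l2:
  fixes x :: "(real ^ 'd::finite) l2"
  shows "(norm x)\<^sup>2 = (\<Sum>i\<in>UNIV. (norm (component_l2 i x))\<^sup>2)"
  by (simp add: power2_norm_eq_inner inner_component_l2[of x])

text \<open>This supplies the existence of an adjoint on the vector-valued space, so that
  \<open>adjoint (kron_id T)\<close> is meaningful there.\<close>

lemma inner_kron_id_adjoint:
  fixes x y :: "(real ^ 'd::finite) l2"
  assumes "\<And>x y. T x \<bullet> y = x \<bullet> T' y"
  shows "kron_id T x \<bullet> y = x \<bullet> kron_id T' y"
  by (simp add: inner_component_l2 assms)

text \<open>Moving each adjoint across the inner product leaves a form in \<open>T\<close> alone;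
  \<open>T'\<close> serves only to witness that an adjoint exists.\<close>

lemma inner_multiplier_op:
  fixes T :: "'a::real_inner \<Rightarrow> 'a"
  assumes "\<And>x y. T x \<bullet> y = x \<bullet> T' y"
  shows "(y, w) \<bullet> multiplier_op T l k (y, w)
    = - 2 * l * (T y \<bullet> y) + 2 * (T y \<bullet> w)
        + 2 * (l * real_of_ereal (1 / k)) * (T w \<bullet> y)
        - 2 * real_of_ereal (1 / k) * (T w \<bullet> w)"
proof -
  have "\<forall>x y. T x \<bullet> y = x \<bullet> adjoint T y"
    unfolding adjoint_def by (rule someI[of _ T']) (simp add: assms)
  then have adj: "x \<bullet> adjoint T y = T x \<bullet> y" for x y
    by simp
  show ?thesis
    by (simp add: multiplier_op_def Let_def inner_add_right inner_diff_right adj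
        inner_commute[of y "T _"] inner_commute[of w "T _"] algebra_simps)
qed

text \<open>Once adjoints are eliminated on both sides, each of the four remaining inner products
  splits over the components.\<close>

lemma inner_multiplier_op_kron_id:
  fixes y w :: "(real ^ 'd::finite) l2"
  assumes "\<And>x y. T x \<bullet> y = x \<bullet> T' y"
  shows "(y, w) \<bullet> multiplier_op (kron_id T) l k (y, w)
    = (\<Sum>i\<in>UNIV. (component_l2 i y, component_l2 i w)
        \<bullet> multiplier_op T l k (component_l2 i y, component_l2 i w))"
  by (simp only: inner_multiplier_op[OF inner_kron_id_adjoint, OF assms]
      inner_multiplier_op[of T T', OF assms])
     (simp add: inner_component_l2 sum.distrib sum_subtractf sum_negf sum_distrib_left mult.assoc)

theorem mainTheorem2:
  fixes l \<epsilon> :: real and k :: ereal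
    and M :: "nat \<Rightarrow> nat \<Rightarrow> real" and G :: "real l2 \<Rightarrow> real l2"
  assumes "l \<le> 0" and "0 < k" and "0 < \<epsilon>"
    and "M \<in> doubly_hyperdominant_toeplitz"
    and "bounded_linear G" and "causal G"
  shows "(\<forall>w :: real l2.
            (G w, w) \<bullet> multiplier_op (matrix_op M) l k (G w, w) \<le> - \<epsilon> * (norm w)\<^sup>2)
         \<longleftrightarrow>
         (\<forall>w :: (real ^ 'd::finite) l2.
            (kron_id G w, w) \<bullet> multiplier_op (kron_id (matrix_op M)) l k (kron_id G w, w)
              \<le> - \<epsilon> * (norm w)\<^sup>2)"
proof -
  let ?q = "\<lambda>w. (G w, w) \<bullet> multiplier_op (matrix_op M) l k (G w, w)"
  note adj = inner_matrix_op_transpose[OF assms(4)]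
  have form: "(kron_id G w, w) \<bullet> multiplier_op (kron_id (matrix_op M)) l k (kron_id G w, w)
      = (\<Sum>i\<in>UNIV. ?q (component_l2 i w))" for w :: "(real ^ 'd) l2"
    by (simp add: inner_multiplier_op_kron_id[OF adj])
  show ?thesis
    unfolding form
  proof (intro iffI allI)
    fix w :: "(real ^ 'd) l2"
    assume "\<forall>w. ?q w \<le> - \<epsilon> * (norm w)\<^sup>2"
    then have "(\<Sum>i\<in>UNIV. ?q (component_l2 i w))
        \<le> (\<Sum>i\<in>UNIV. - \<epsilon> * (norm (component_l2 i w))\<^sup>2)"
      by (intro sum_mono) blast
    \<comment> \<open>The scalar bounds add up with the same \<open>\<epsilon>\<close>, since
      squared norms of components sum to that of \<open>w\<close>.\<close>
    then show "(\<Sum>i\<in>UNIV. ?q (component_l2 i w)) \<le> - \<epsilon> * (norm w)\<^sup>2"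
      by (simp only: norm_component_l2[of w] sum_distrib_left)
  next
    fix w :: "real l2"
    assume *: "\<forall>w :: (real ^ 'd) l2. (\<Sum>i\<in>UNIV. ?q (component_l2 i w)) \<le> - \<epsilon> * (norm w)\<^sup>2"
    \<comment> \<open>Any index will do, as types are nonempty: \<open>v\<close> carries
      \<open>w\<close> in component \<open>a\<close> and zero elsewhere.\<close>
    define a :: 'd where "a = undefined"
    define v where "v = vector_l2 (\<lambda>i. if i = a then w else 0)"
    \<comment> \<open>Linearity gives \<open>G 0 = 0\<close>, so the zero components of
      \<open>v\<close> contribute nothing to the form.\<close>
    have q0: "?q 0 = 0"
      by (simp add: inner_multiplier_op[OF adj] linear_0[OF bounded_linear.linear[OF assms(5)]])
    have "(\<Sum>i\<in>UNIV. ?q (component_l2 i v)) = (\<Sum>i\<in>UNIV. if i = a then ?q w else 0)"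
      by (intro sum.cong refl) (simp add: v_def q0 del: inner_Pair)
    moreover have "(norm v)\<^sup>2 = (\<Sum>i\<in>UNIV. if i = a then (norm w)\<^sup>2 else 0)"
      unfolding norm_component_l2 by (intro sum.cong refl) (simp add: v_def)
    ultimately show "?q w \<le> - \<epsilon> * (norm w)\<^sup>2"
      using *[rule_format, of v] by simp
  qed
qed

end
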